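(* Fix $d\ge 2$. The following quantities are defined for $k\ge d+1$, and they satisfy \[ \operatorname{EM}^{(d)}(k)=\operatorname{AB}^{(d)}_{\mathrm{mc}}(k)\le \operatorname{AB}^{(d)}(k)\le \overline R_{\mathrm{mon}}(k;d+1). \] Definitions. Write points of $\mathbb R^d$ as $x=(z,h)$ with $z\in\mathbb R^{d-1}$, $h\in\mathbb R$, and let $\pi(z,h)=z$. A sequence $x_1,\dots,x_N\in\mathbb R^d$ has \emph{cyclic projections} if the projected sequence $z_i=\pi(x_i)$ has the same order type as points $(t_i,t_i^2,\dots,t_i^{d-1})$ on the moment curve with $t_1<\cdots<t_N$; that is, for every $i_1<\cdots<i_d$ the $d\times d$ determinant with columns $\binom{1}{z_{i_1}},\dots,\binom{1}{z_{i_d}}$ is positive. For such a sequence and indices $i_0<i_1<\cdots<i_d$, the points $z_{i_0},\dots,z_{i_d}$ have the alternating Radon partition: there are positive coefficients $\alpha_j$ ($j$ even) and $\beta_j$ ($j$ odd) with $\sum_{j\text{ even}}\alpha_j=\sum_{j\text{ odd}}\beta_j=1$ and $\sum_{j\text{ even}}\alpha_jz_{i_j}=\sum_{j\text{ odd}}\beta_jz_{i_j}$. Set $H_{\mathrm{even}}=\sum_{j\text{ even}}\alpha_jh_{i_j}$ and $H_{\mathrm{odd}}=\sum_{j\text{ odd}}\beta_jh_{i_j}$; the \emph{above--below color} of the $(d+1)$-tuple $i_0<\cdots<i_d$ records whether $H_{\mathrm{even}}>H_{\mathrm{odd}}$ or the reverse. $\operatorname{AB}^{(d)}(k)$ is the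 smallest $N$ such that every sequence $x_1,\dots,x_N\in\mathbb R^d$ in general position with cyclic projections contains indices $i_1<\cdots<i_k$ such that all $(d+1)$-tuples among them receive the same above--below color. $\operatorname{AB}^{(d)}_{\mathrm{mc}}(k)$ is defined in the same way but only over sequences (in general position) of the form $x_i=(t_i,t_i^2,\dots,t_i^{d-1},h_i)$ with $t_1<\cdots<t_N$. For planar points $p_i=(t_i,h_i)$ with distinct $t_i$, the $d$-th divided difference is \[ \Delta_d(p_{i_0},\dots,p_{i_d})=\sum_{j=0}^d\frac{h_{i_j}}{\prod_{r\ne j}(t_{i_j}-t_{i_r})}. \] A set of such points is in \emph{$d$-general position} if every $(d+1)$-tuple has nonzero $\Delta_d$. $\operatorname{EM}^{(d)}(k)$ is the smallest $N$ such that every sequence $p_1,\dots,p_N$, $p_i=(t_i,h_i)$, $t_1<\cdots<t_N$, in $d$-general position contains a subsequence of $k$ points all of whose $(d+1)$-tuples have $\Delta_d$ of the same sign. For $r\ge 2$, a two-coloring $\chi:\binom{[N]}{r}\to\{+,-\}$ is \emph{$r$-monotone} if for every $i_0<\cdots<i_r$, the sequence of colors of the $r$-subsets of $\{i_0,\dots,i_r\}$, listed in lexicographic order, changes sign at most once. $\overline R_{\mathrm{mon}}(k;r)$ is the least $N$ such that every $r$-monotone coloring of $\binom{[N]}{r}$ contains a $k$-element subset all of whose $r$-subsets have the same color. *)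

theory Defs
  imports
    Complex_Main
    "HOL-Library.Ramsey"
    "HOL-Library.List_Lexorder"
    "Jordan_Normal_Form.Determinant"
begin

text \<open>A sequence of length \<open>N\<close> is a function on \<open>nat\<close> of which only the values at
  \<open>0, \<dots>, N - 1\<close> matter; an increasing \<open>m\<close>-tuple of indices from \<open>S\<close> is likewise a function
  on \<open>nat\<close> of which only the values at \<open>0, \<dots>, m - 1\<close> matter. Points of
  \<open>d\<close>-dimensional space are vectors in \<open>carrier_vec d\<close>; the last coordinate is the height.\<close>

definition increasing_tuples :: "nat \<Rightarrow> nat set \<Rightarrow> (nat \<Rightarrow> nat) set" where
  "increasing_tuples m S = {i. strict_mono_on {..<m} i \<and> i ` {..<m} \<subseteq> S}"


definition projection :: "nat \<Rightarrow> real vec \<Rightarrow> real vec" where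
  "projection d x = vec_first x (d - 1)"

definition height :: "nat \<Rightarrow> real vec \<Rightarrow> real" where
  "height d x = x $ (d - 1)"

definition cyclic_projections :: "nat \<Rightarrow> nat \<Rightarrow> (nat \<Rightarrow> real vec) \<Rightarrow> bool" where
  "cyclic_projections d N x \<longleftrightarrow>
     (\<forall>i \<in> increasing_tuples d {..<N}.
        det (mat_of_cols d (map (\<lambda>s. vCons 1 (projection d (x (i s)))) [0..<d])) > 0)"

text \<open>General position: no \<open>d + 1\<close> of the points lie on a common hyperplane.\<close>

definition general_position :: "nat \<Rightarrow> nat \<Rightarrow> (nat \<Rightarrow> real vec) \<Rightarrow> bool" where
  "general_position d N x \<longleftrightarrow>
     (\<forall>i \<in> increasing_tuples (d + 1) {..<N}.
        \<not> (\<exists>a \<in> carrier_vec d. \<exists>b. a \<noteq> 0\<^sub>v d \<and> (\<forall>s \<le> d. a \<bullet> x (i s) = b)))"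

text \<open>The coefficients \<open>\<alpha>\<^sub>j\<close> (\<open>j\<close> even) and \<open>\<beta>\<^sub>j\<close> (\<open>j\<close> odd) are the values of one
  function \<open>c\<close>; \<open>y\<close> lists the \<open>d + 1\<close> points of the tuple.\<close>

definition alternating_radon_partition :: "nat \<Rightarrow> (nat \<Rightarrow> real vec) \<Rightarrow> (nat \<Rightarrow> real) \<Rightarrow> bool" where
  "alternating_radon_partition d y c \<longleftrightarrow>
     (\<forall>j \<le> d. c j > 0) \<and>
     (\<Sum>j | j \<le> d \<and> even j. c j) = 1 \<and>
     (\<Sum>j | j \<le> d \<and> odd j. c j) = 1 \<and>
     (\<forall>a < d - 1. (\<Sum>j | j \<le> d \<and> even j. c j * projection d (y j) $ a) =
                  (\<Sum>j | j \<le> d \<and> odd j. c j * projection d (y j) $ a))"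

definition H_even :: "nat \<Rightarrow> (nat \<Rightarrow> real vec) \<Rightarrow> (nat \<Rightarrow> real) \<Rightarrow> real" where
  "H_even d y c = (\<Sum>j | j \<le> d \<and> even j. c j * height d (y j))"

definition H_odd :: "nat \<Rightarrow> (nat \<Rightarrow> real vec) \<Rightarrow> (nat \<Rightarrow> real) \<Rightarrow> real" where
  "H_odd d y c = (\<Sum>j | j \<le> d \<and> odd j. c j * height d (y j))"

text \<open>The two above--below colors. For cyclic projections the coefficients \<open>c\<close> exist and are
  unique, and in general position the two heights differ, so exactly one of the two holds.\<close>

definition even_above :: "nat \<Rightarrow> (nat \<Rightarrow> real vec) \<Rightarrow> bool" where
  "even_above d y \<longleftrightarrow> (\<exists>c. alternating_radon_partition d y c \<and> H_even d y c > H_odd d y c)"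

definition odd_above :: "nat \<Rightarrow> (nat \<Rightarrow> real vec) \<Rightarrow> bool" where
  "odd_above d y \<longleftrightarrow> (\<exists>c. alternating_radon_partition d y c \<and> H_even d y c < H_odd d y c)"

definition AB_homogeneous :: "nat \<Rightarrow> (nat \<Rightarrow> real vec) \<Rightarrow> nat set \<Rightarrow> bool" where
  "AB_homogeneous d x S \<longleftrightarrow>
     (\<forall>i \<in> increasing_tuples (d + 1) S. even_above d (x \<circ> i)) \<or>
     (\<forall>i \<in> increasing_tuples (d + 1) S. odd_above d (x \<circ> i))"

definition AB_property :: "nat \<Rightarrow> nat \<Rightarrow> nat \<Rightarrow> bool" where
  "AB_property d k N \<longleftrightarrow>
     (\<forall>x. (\<forall>i < N. x i \<in> carrier_vec d) \<and> general_position d N x \<and> cyclic_projections d N x \<longrightarrow>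
        (\<exists>S \<in> [{..<N}]\<^bsup>k\<^esup>. AB_homogeneous d x S))"

definition AB :: "nat \<Rightarrow> nat \<Rightarrow> nat" where
  "AB d k = (LEAST N. AB_property d k N)"

definition moment_point :: "nat \<Rightarrow> real \<Rightarrow> real \<Rightarrow> real vec" where
  "moment_point d t h = vec d (\<lambda>a. if a < d - 1 then t ^ (a + 1) else h)"

definition AB_mc_property :: "nat \<Rightarrow> nat \<Rightarrow> nat \<Rightarrow> bool" where
  "AB_mc_property d k N \<longleftrightarrow>
     (\<forall>t h. strict_mono_on {..<N} t \<and> general_position d N (\<lambda>i. moment_point d (t i) (h i)) \<longrightarrow>
        (\<exists>S \<in> [{..<N}]\<^bsup>k\<^esup>. AB_homogeneous d (\<lambda>i. moment_point d (t i) (h i)) S))"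

definition AB_mc :: "nat \<Rightarrow> nat \<Rightarrow> nat" where
  "AB_mc d k = (LEAST N. AB_mc_property d k N)"


definition divided_difference :: "nat \<Rightarrow> (nat \<Rightarrow> real \<times> real) \<Rightarrow> real" where
  "divided_difference d q =
     (\<Sum>j \<le> d. snd (q j) / (\<Prod>r \<in> {..d} - {j}. fst (q j) - fst (q r)))"

definition d_general_position :: "nat \<Rightarrow> nat \<Rightarrow> (nat \<Rightarrow> real \<times> real) \<Rightarrow> bool" where
  "d_general_position d N p \<longleftrightarrow>
     (\<forall>i \<in> increasing_tuples (d + 1) {..<N}. divided_difference d (p \<circ> i) \<noteq> 0)"

definition EM_homogeneous :: "nat \<Rightarrow> (nat \<Rightarrow> real \<times> real) \<Rightarrow> nat set \<Rightarrow> bool" where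
  "EM_homogeneous d p S \<longleftrightarrow>
     (\<forall>i \<in> increasing_tuples (d + 1) S. divided_difference d (p \<circ> i) > 0) \<or>
     (\<forall>i \<in> increasing_tuples (d + 1) S. divided_difference d (p \<circ> i) < 0)"

definition EM_property :: "nat \<Rightarrow> nat \<Rightarrow> nat \<Rightarrow> bool" where
  "EM_property d k N \<longleftrightarrow>
     (\<forall>p. strict_mono_on {..<N} (\<lambda>i. fst (p i)) \<and> d_general_position d N p \<longrightarrow>
        (\<exists>S \<in> [{..<N}]\<^bsup>k\<^esup>. EM_homogeneous d p S))"

definition EM :: "nat \<Rightarrow> nat \<Rightarrow> nat" where
  "EM d k = (LEAST N. EM_property d k N)"


text \<open>The \<open>r\<close>-subsets of \<open>J\<close> in lexicographic order, each given as the increasing list of its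
  elements; the outer sorting uses the lexicographic order on \<open>nat list\<close>.\<close>

definition lex_subsets :: "nat \<Rightarrow> nat set \<Rightarrow> nat list list" where
  "lex_subsets r J = sorted_list_of_set (sorted_list_of_set ` [J]\<^bsup>r\<^esup>)"

definition sign_changes :: "bool list \<Rightarrow> nat" where
  "sign_changes cs = card {s. Suc s < length cs \<and> cs ! s \<noteq> cs ! Suc s}"

text \<open>A coloring of the \<open>r\<close>-subsets of \<open>{..<N}\<close> is a function on all finite sets; only its
  values on \<open>r\<close>-subsets of \<open>{..<N}\<close> matter. The colors are \<open>True\<close> and \<open>False\<close>.\<close>

definition monotone_coloring :: "nat \<Rightarrow> nat \<Rightarrow> (nat set \<Rightarrow> bool) \<Rightarrow> bool" where
  "monotone_coloring r N \<chi> \<longleftrightarrow>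
     (\<forall>J \<in> nsets {..<N} (r + 1). sign_changes (map (\<lambda>l. \<chi> (set l)) (lex_subsets r J)) \<le> 1)"

definition R_mon_property :: "nat \<Rightarrow> nat \<Rightarrow> nat \<Rightarrow> bool" where
  "R_mon_property k r N \<longleftrightarrow>
     (\<forall>\<chi>. monotone_coloring r N \<chi> \<longrightarrow>
        (\<exists>S \<in> [{..<N}]\<^bsup>k\<^esup>. \<exists>c. \<forall>T \<in> [S]\<^bsup>r\<^esup>. \<chi> T = c))"

definition R_mon :: "nat \<Rightarrow> nat \<Rightarrow> nat" where
  "R_mon k r = (LEAST N. R_mon_property k r N)"

end

theory Submission
  imports Defs
begin

text \<open>The above--below color of a \<open>(d + 1)\<close>-tuple is the sign of the combination of the heights
  with the coefficients of the alternating affine dependence of the projections, which is unique up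
  to a positive factor. On the moment curve this dependence is given by the Lagrange weights
  \<open>1 / (\<Prod>r\<noteq>j. t\<^sub>j - t\<^sub>r)\<close>, so the color is the sign of the divided difference
  up to the global factor \<open>(-1)\<^sup>d\<close>. For \<open>d + 2\<close> points and \<open>p < q < r\<close>, the dependence
  omitting \<open>q\<close> is a positive combination of those omitting \<open>p\<close> and \<open>r\<close>, so no color
  pattern \<open>+ - +\<close> or \<open>- + -\<close> occurs and the coloring is monotone. Ramsey's theorem makes all
  quantities finite.\<close>

section \<open>Vandermonde determinants and Lagrange weights\<close>

text \<open>The kernel criterion for singular matrices, with the kernel vector as a function on
  \<open>nat\<close>, the form in which dependences among points are handled below.\<close>

lemma det_eq_0_iff_columns_dependent:
  fixes W :: "nat \<Rightarrow> nat \<Rightarrow> 'a::field"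
  shows "det (mat n n (\<lambda>(a, s). W a s)) = 0 \<longleftrightarrow>
    (\<exists>u. (\<exists>s<n. u s \<noteq> 0) \<and> (\<forall>a<n. (\<Sum>s<n. W a s * u s) = 0))" (is "_ \<longleftrightarrow> ?R")
proof -
  let ?A = "mat n n (\<lambda>(a, s). W a s)"
  have entry: "(?A *\<^sub>v v) $ a = (\<Sum>s<n. W a s * v $ s)" if "a < n" "v \<in> carrier_vec n" for a v
    using that by (auto simp: scalar_prod_def lessThan_atLeast0 intro!: sum.cong)
  have "det ?A = 0 \<longleftrightarrow> (\<exists>v. v \<in> carrier_vec n \<and> v \<noteq> 0\<^sub>v n \<and> ?A *\<^sub>v v = 0\<^sub>v n)"
    by (rule det_0_iff_vec_prod_zero_field) auto
  also have "\<dots> \<longleftrightarrow> ?R"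
  proof
    assume "\<exists>v. v \<in> carrier_vec n \<and> v \<noteq> 0\<^sub>v n \<and> ?A *\<^sub>v v = 0\<^sub>v n"
    then obtain v where v: "v \<in> carrier_vec n" "v \<noteq> 0\<^sub>v n" "?A *\<^sub>v v = 0\<^sub>v n" by blast
    have "\<exists>s<n. v $ s \<noteq> 0" using v by (auto simp: vec_eq_iff)
    moreover have "\<forall>a<n. (\<Sum>s<n. W a s * v $ s) = 0"
      using entry v by (metis index_zero_vec(1))
    ultimately show ?R by blast
  next
    assume ?R
    then obtain u where u: "\<exists>s<n. u s \<noteq> 0" "\<forall>a<n. (\<Sum>s<n. W a s * u s) = 0" by blast
    have "vec n u \<noteq> 0\<^sub>v n" using u(1) by (auto simp: vec_eq_iff)
    moreover have "?A *\<^sub>v vec n u = 0\<^sub>v n"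
    proof (rule eq_vecI)
      fix a assume "a < dim_vec (0\<^sub>v n :: 'a vec)"
      then show "(?A *\<^sub>v vec n u) $ a = 0\<^sub>v n $ a"
        using u(2) entry[of a "vec n u"] by simp
    qed simp
    ultimately show "\<exists>v. v \<in> carrier_vec n \<and> v \<noteq> 0\<^sub>v n \<and> ?A *\<^sub>v v = 0\<^sub>v n"
      by (intro exI[of _ "vec n u"]) simp
  qed
  finally show ?thesis .
qed

lemma det_eq_0_iff_rows_dependent:
  fixes W :: "nat \<Rightarrow> nat \<Rightarrow> 'a::field"
  shows "det (mat n n (\<lambda>(a, s). W a s)) = 0 \<longleftrightarrow>
    (\<exists>u. (\<exists>a<n. u a \<noteq> 0) \<and> (\<forall>s<n. (\<Sum>a<n. u a * W a s) = 0))"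
proof -
  have "det (mat n n (\<lambda>(a, s). W a s)) = det (transpose_mat (mat n n (\<lambda>(a, s). W a s)))"
    by (rule det_transpose[symmetric, of _ n]) auto
  also have "transpose_mat (mat n n (\<lambda>(a, s). W a s)) = mat n n (\<lambda>(s, a). W a s)"
    by (rule eq_matI) auto
  finally show ?thesis
    using det_eq_0_iff_columns_dependent[of n "\<lambda>s a. W a s"] by (simp add: mult.commute)
qed

text \<open>By induction: adding multiples of the other rows to the last one turns it into the
  values of the monic polynomial \<open>q\<close> with roots \<open>t 0, ..., t (n - 1)\<close>, so
  only the entry at \<open>t n\<close> survives, and it is positive.\<close>

lemma vandermonde_det_pos:
  fixes t :: "nat \<Rightarrow> 'a::linordered_field"
  assumes "strict_mono_on {..<n} t"
  shows "det (mat n n (\<lambda>(a, s). t s ^ a)) > 0"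
  using assms
proof (induction n)
  case 0
  then show ?case by (simp add: det_dim_zero)
next
  case (Suc n)
  let ?N = "Suc n"
  let ?V = "mat ?N ?N (\<lambda>(a, s). t s ^ a)"
  define q where "q = (\<Prod>i<n. [:- t i, 1:])"
  have degq: "degree q = n"
    unfolding q_def by (subst degree_prod_eq_sum_degree) auto
  have lcq: "coeff q n = 1"
    using degq lead_coeff_prod[of "\<lambda>i. [:- t i, 1:]" "{..<n}"] by (simp add: q_def)
  \<comment> \<open>Left multiplication by \<open>B\<close> performs the row operation: unit rows on
    top, the coefficients of \<open>q\<close> below. The diagonal is 1 because \<open>q\<close> is
    monic.\<close>
  define B where "B = mat ?N ?N (\<lambda>(a, b). if a < n then if a = b then 1 else 0 else coeff q b)"
  have B: "B \<in> carrier_mat ?N ?N" by (simp add: B_def)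
  have "det B = prod_list (diag_mat B)"
    by (rule det_lower_triangular[OF _ B]) (auto simp: B_def)
  also have "\<dots> = 1"
    using lcq by (auto simp: prod_list_diag_prod B_def less_Suc_eq intro!: prod.neutral)
  finally have detB: "det B = 1" .
  have BV: "B * ?V = mat ?N ?N (\<lambda>(a, s). if a < n then t s ^ a else poly q (t s))"
  proof (rule eq_matI)
    fix a s assume "a < dim_row (mat ?N ?N (\<lambda>(a, s). if a < n then t s ^ a else poly q (t s)))"
      "s < dim_col (mat ?N ?N (\<lambda>(a, s). if a < n then t s ^ a else poly q (t s)))"
    then have as: "a < ?N" "s < ?N" by auto
    have "(B * ?V) $$ (a, s) = (\<Sum>b<?N. (if a < n then if a = b then 1 else 0 else coeff q b) * t s ^ b)"
      using as by (auto simp: B_def scalar_prod_def lessThan_atLeast0 intro!: sum.cong)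
    also have "\<dots> = (if a < n then t s ^ a else poly q (t s))"
    proof (cases "a < n")
      case True
      have "(\<Sum>b<?N. (if a = b then 1 else 0) * t s ^ b) = (\<Sum>b<?N. if a = b then t s ^ b else 0)"
        by (rule sum.cong) auto
      with True show ?thesis by simp
    qed (simp add: poly_altdef degq lessThan_Suc_atMost)
    finally show "(B * ?V) $$ (a, s) = mat ?N ?N (\<lambda>(a, s). if a < n then t s ^ a else poly q (t s)) $$ (a, s)"
      using as by simp
  qed (auto simp: B_def)
  have q0: "poly q (t s) = 0" if "s < n" for s
    unfolding q_def poly_prod using that by (intro prod_zero) auto
  have qpos: "poly q (t n) > 0"
    unfolding q_def poly_prod using Suc.prems by (auto intro!: prod_pos simp: strict_mono_on_def)
  have "det ?V = det (B * ?V)"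
    using detB by (simp add: det_mult[OF B])
  also have "\<dots> = (\<Sum>s<?N. (B * ?V) $$ (n, s) * cofactor (B * ?V) n s)"
    by (rule laplace_expansion_row[of _ ?N]) (auto simp: B_def)
  also have "\<dots> = poly q (t n) * cofactor (B * ?V) n n"
    using q0 by (simp add: BV)
  also have "cofactor (B * ?V) n n = det (mat n n (\<lambda>(a, s). t s ^ a))"
    unfolding BV cofactor_def mat_delete_def
    by (simp, intro arg_cong[of _ _ det] eq_matI) auto
  finally have "det ?V = poly q (t n) * det (mat n n (\<lambda>(a, s). t s ^ a))" .
  moreover have "det (mat n n (\<lambda>(a, s). t s ^ a)) > 0"
    using Suc.prems by (intro Suc.IH) (auto simp: strict_mono_on_def)
  ultimately show ?case using qpos by simp
qed

text \<open>The sum is the coefficient of degree \<open>d\<close> in the Lagrange interpolant of the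
  monomial of degree \<open>a\<close> at \<open>d + 1\<close> nodes. The interpolant is that
  monomial itself, and \<open>a < d\<close>.\<close>

lemma lagrange_weights_annihilate_powers:
  fixes t :: "nat \<Rightarrow> 'a::field"
  assumes inj: "inj_on t {..d}" and "a < d"
  shows "(\<Sum>j\<le>d. t j ^ a / (\<Prod>r\<in>{..d} - {j}. t j - t r)) = 0"
proof -
  define w where "w j = t j ^ a / (\<Prod>r\<in>{..d} - {j}. t j - t r)" for j
  define l where "l j = (\<Prod>r\<in>{..d} - {j}. [:- t r, 1:])" for j
  define P where "P = (\<Sum>j\<le>d. smult (w j) (l j))"
  have deg: "degree (l j) = d" if "j \<le> d" for j
    unfolding l_def using that by (subst degree_prod_eq_sum_degree) (auto simp: card_Diff_singleton)
  have lc: "coeff (l j) d = 1" if "j \<le> d" for j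
    using deg[OF that] lead_coeff_prod[of "\<lambda>r. [:- t r, 1:]" "{..d} - {j}"] by (simp add: l_def)
  have val: "poly (l j) (t m) = (if j = m then (\<Prod>r\<in>{..d} - {j}. t j - t r) else 0)"
    if "j \<le> d" "m \<le> d" for j m
    using that by (auto simp: l_def poly_prod intro!: prod_zero)
  have nz: "(\<Prod>r\<in>{..d} - {j}. t j - t r) \<noteq> 0" if "j \<le> d" for j
    using that inj by (auto simp: inj_on_def)
  have Pt: "poly P (t m) = t m ^ a" if "m \<le> d" for m
  proof -
    have "poly P (t m) = (\<Sum>j\<le>d. if j = m then t m ^ a else 0)"
      unfolding P_def poly_sum using that val nz by (intro sum.cong) (auto simp: w_def)
    with that show ?thesis by simp
  qed
  have "degree P \<le> d"
    unfolding P_def using deg by (intro degree_sum_le) (auto simp: degree_smult_le[THEN order_trans])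
  then have "P = monom 1 a"
    using \<open>a < d\<close> Pt inj
    by (intro poly_eqI_degree[of "t ` {..d}"]) (auto simp: poly_monom degree_monom_eq card_image)
  then have "coeff P d = 0" using \<open>a < d\<close> by simp
  moreover have "coeff P d = (\<Sum>j\<le>d. w j)"
    unfolding P_def coeff_sum using lc by (intro sum.cong) auto
  ultimately show ?thesis by (simp add: w_def)
qed

section \<open>Alternating affine dependences\<close>

text \<open>Coordinates \<open>0, \<dots>, d - 1\<close> of the lifted point are \<open>1\<close> and the projection;
  coordinate \<open>d\<close> is the height.\<close>

definition lifted_coord :: "real vec \<Rightarrow> nat \<Rightarrow> real" where
  "lifted_coord x a = (if a = 0 then 1 else x $ (a - 1))"

text \<open>Only coordinates below \<open>d\<close> enter, so the heights are ignored: this is the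
  orientation determinant of the first \<open>d\<close> projections.\<close>

definition lifted_det :: "nat \<Rightarrow> (nat \<Rightarrow> real vec) \<Rightarrow> real" where
  "lifted_det d y = det (mat d d (\<lambda>(a, s). lifted_coord (y s) a))"

text \<open>\<open>insert_index j\<close> skips \<open>j\<close>, so these are the maximal minors of
  the matrix of \<open>d + 1\<close> lifted projections.\<close>

definition cyclic_tuple :: "nat \<Rightarrow> (nat \<Rightarrow> real vec) \<Rightarrow> bool" where
  "cyclic_tuple d y \<longleftrightarrow> (\<forall>j\<le>d. lifted_det d (y \<circ> insert_index j) > 0)"

text \<open>Coordinate 0 makes the coefficients sum to zero; the other coordinates below
  \<open>d\<close> concern the projections. The height is left free.\<close>

definition affine_dependence :: "nat \<Rightarrow> (nat \<Rightarrow> real vec) \<Rightarrow> (nat \<Rightarrow> real) \<Rightarrow> bool" where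
  "affine_dependence d y e \<longleftrightarrow> (\<forall>a<d. (\<Sum>j\<le>d. e j * lifted_coord (y j) a) = 0)"

text \<open>For an alternating dependence this is a positive multiple of the difference of
  \<open>H_even\<close> and \<open>H_odd\<close>, hence carries the color.\<close>

definition height_sum :: "nat \<Rightarrow> (nat \<Rightarrow> real vec) \<Rightarrow> (nat \<Rightarrow> real) \<Rightarrow> real" where
  "height_sum d y e = (\<Sum>j\<le>d. e j * lifted_coord (y j) d)"

definition alternating_signs :: "nat \<Rightarrow> (nat \<Rightarrow> real) \<Rightarrow> bool" where
  "alternating_signs d e \<longleftrightarrow> (\<forall>j\<le>d. (-1) ^ j * e j > 0)"

lemma alternating_signs_nonzero: "alternating_signs d e \<Longrightarrow> j \<le> d \<Longrightarrow> e j \<noteq> 0"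
  by (auto simp: alternating_signs_def)

lemma cyclic_projections_iff:
  assumes "d \<ge> 1"
  shows "cyclic_projections d N x \<longleftrightarrow> (\<forall>i\<in>increasing_tuples d {..<N}. lifted_det d (x \<circ> i) > 0)"
proof -
  have "mat_of_cols d (map (\<lambda>s. vCons 1 (projection d (x (i s)))) [0..<d]) =
      mat d d (\<lambda>(a, s). lifted_coord ((x \<circ> i) s) a)" for i
    by (rule eq_matI)
      (auto simp: mat_of_cols_def lifted_coord_def projection_def vec_first_def vec_index_vCons)
  then show ?thesis by (simp add: cyclic_projections_def lifted_det_def)
qed

lemma increasing_tuples_insert_index:
  assumes "i \<in> increasing_tuples (Suc m) S" "j \<le> m"
  shows "i \<circ> insert_index j \<in> increasing_tuples m S"
  using assms by (fastforce simp: increasing_tuples_def strict_mono_on_def insert_index_def)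

lemma cyclic_projections_imp_cyclic_tuple:
  assumes "d \<ge> 1" "cyclic_projections d N x" "i \<in> increasing_tuples (Suc d) {..<N}"
  shows "cyclic_tuple d (x \<circ> i)"
  using assms increasing_tuples_insert_index[OF assms(3)]
  by (simp add: cyclic_projections_iff cyclic_tuple_def comp_assoc)

lemma cyclic_tuple_det_pos:
  assumes "cyclic_tuple d y"
  shows "lifted_det d y > 0"
proof -
  \<comment> \<open>\<open>insert_index d\<close> is the identity below \<open>d\<close>, so
    omitting the last point is the case needed.\<close>
  have "lifted_det d (y \<circ> insert_index d) = lifted_det d y"
    unfolding lifted_det_def by (intro arg_cong[of _ _ det] eq_matI) auto
  with assms show ?thesis by (metis cyclic_tuple_def order_refl)
qed

text \<open>Expanding a determinant with a repeated row along one copy of that row turns the maximal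
  minors into the coefficients of an affine dependence.\<close>

lemma cyclic_tuple_dependence:
  assumes "cyclic_tuple d y"
  obtains e where "affine_dependence d y e" "alternating_signs d e"
proof
  define e where "e j = (-1) ^ j * lifted_det d (y \<circ> insert_index j)" for j
  show "alternating_signs d e"
    using assms by (simp add: alternating_signs_def cyclic_tuple_def e_def flip: mult.assoc power_add)
  show "affine_dependence d y e"
    unfolding affine_dependence_def
  proof (intro allI impI)
    fix a assume "a < d"
    define A where "A = mat (Suc d) (Suc d)
      (\<lambda>(b, s). lifted_coord (y s) (if b = 0 then a else b - 1))"
    have A: "A \<in> carrier_mat (Suc d) (Suc d)" by (simp add: A_def)
    have "row A 0 = row A (Suc a)"
      using \<open>a < d\<close> by (auto simp: A_def row_def)
    then have "det A = 0"
      using \<open>a < d\<close> by (intro det_identical_rows[OF A, of 0 "Suc a"]) auto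
    moreover have "det A = (\<Sum>j<Suc d. A $$ (0, j) * cofactor A 0 j)"
      by (rule laplace_expansion_row[OF A]) simp
    moreover have "A $$ (0, j) * cofactor A 0 j = e j * lifted_coord (y j) a" if "j < Suc d" for j
    proof -
      have "mat_delete A 0 j = mat d d (\<lambda>(a, s). lifted_coord ((y \<circ> insert_index j) s) a)"
        using that by (intro eq_matI) (auto simp: A_def mat_delete_def insert_index_def)
      then show ?thesis
        using that by (simp add: cofactor_def e_def lifted_det_def A_def)
    qed
    ultimately show "(\<Sum>j\<le>d. e j * lifted_coord (y j) a) = 0"
      by (simp add: lessThan_Suc_atMost)
  qed
qed

text \<open>Subtracting the multiple of \<open>f\<close> that cancels entry \<open>d\<close> leaves
  a linear relation among the first \<open>d\<close> lifted projections, which are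
  independent.\<close>

lemma affine_dependence_unique:
  assumes "lifted_det d y \<noteq> 0" "affine_dependence d y e" "affine_dependence d y f" "f d \<noteq> 0"
  shows "\<forall>j\<le>d. e j = e d / f d * f j"
proof -
  define g where "g j = e j - e d / f d * f j" for j
  have "g d = 0" using assms(4) by (simp add: g_def)
  have "(\<Sum>s<d. lifted_coord (y s) a * g s) = 0" if "a < d" for a
  proof -
    have "(\<Sum>s<d. lifted_coord (y s) a * g s) = (\<Sum>j\<le>d. lifted_coord (y j) a * g j)"
      using \<open>g d = 0\<close> by (simp flip: lessThan_Suc_atMost)
    also have "\<dots> = (\<Sum>j\<le>d. e j * lifted_coord (y j) a) -
        e d / f d * (\<Sum>j\<le>d. f j * lifted_coord (y j) a)"
      by (simp add: g_def sum_subtractf sum_distrib_left algebra_simps)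
    also have "\<dots> = 0" using assms(2,3) that by (simp add: affine_dependence_def)
    finally show ?thesis .
  qed
  then have "\<forall>s<d. g s = 0"
    using assms(1) det_eq_0_iff_columns_dependent[of d "\<lambda>a s. lifted_coord (y s) a"]
    unfolding lifted_det_def by blast
  with \<open>g d = 0\<close> have "\<forall>j\<le>d. g j = 0" by (metis le_neq_implies_less)
  then show ?thesis unfolding g_def right_minus_eq .
qed

lemma height_sum_scale:
  assumes "\<forall>j\<le>d. e j = s * f j"
  shows "height_sum d y e = s * height_sum d y f"
  using assms by (simp add: height_sum_def sum_distrib_left mult.assoc)

text \<open>The proportionality factor \<open>e d / f d\<close> is positive, as both entries have
  sign \<open>(-1) ^ d\<close>. Hence any alternating dependence may be used to read off a
  color.\<close>

lemma alternating_dependences_same_sign: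
  assumes "cyclic_tuple d y" "affine_dependence d y e" "affine_dependence d y f"
    and "alternating_signs d e" "alternating_signs d f"
  shows "sgn (height_sum d y e) = sgn (height_sum d y f)"
proof -
  have "f d \<noteq> 0" using assms(5) by (simp add: alternating_signs_nonzero)
  have "e d / f d = ((-1) ^ d * e d) / ((-1) ^ d * f d)" by simp
  also have "\<dots> > 0" using assms(4,5) unfolding alternating_signs_def by (intro divide_pos_pos) auto
  finally have "e d / f d > 0" .
  moreover have "height_sum d y e = e d / f d * height_sum d y f"
    using assms cyclic_tuple_det_pos[of d y] \<open>f d \<noteq> 0\<close>
    by (intro height_sum_scale affine_dependence_unique) auto
  ultimately show ?thesis by (simp only: sgn_mult sgn_pos mult_1)
qed

section \<open>Radon partitions and above-below colors\<close>

lemma sum_even_odd: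
  fixes g :: "nat \<Rightarrow> 'a::comm_ring_1"
  shows "(\<Sum>j\<le>d. (-1) ^ j * g j) = (\<Sum>j | j \<le> d \<and> even j. g j) - (\<Sum>j | j \<le> d \<and> odd j. g j)"
proof -
  have "(\<Sum>j\<le>d. (-1) ^ j * g j) =
      (\<Sum>j\<in>{j. j \<le> d \<and> even j} \<union> {j. j \<le> d \<and> odd j}. (-1) ^ j * g j)"
    by (rule sum.cong) auto
  also have "\<dots> = (\<Sum>j | j \<le> d \<and> even j. (-1) ^ j * g j) + (\<Sum>j | j \<le> d \<and> odd j. (-1) ^ j * g j)"
    by (rule sum.union_disjoint) auto
  also have "(\<Sum>j | j \<le> d \<and> even j. (-1) ^ j * g j) = (\<Sum>j | j \<le> d \<and> even j. g j)"
    by (rule sum.cong) auto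
  also have "(\<Sum>j | j \<le> d \<and> odd j. (-1) ^ j * g j) = - (\<Sum>j | j \<le> d \<and> odd j. g j)"
    unfolding sum_negf[symmetric] by (rule sum.cong) auto
  finally show ?thesis by simp
qed

text \<open>Moving the odd side over with a minus sign gives an affine dependence. Its coordinate 0
  equates the two coefficient sums, so normalizing the even one suffices.\<close>

lemma alternating_radon_partition_iff:
  assumes "d \<ge> 1"
  shows "alternating_radon_partition d y c \<longleftrightarrow> (\<forall>j\<le>d. c j > 0) \<and>
    (\<Sum>j | j \<le> d \<and> even j. c j) = 1 \<and> affine_dependence d y (\<lambda>j. (-1) ^ j * c j)"
proof -
  have all: "(\<forall>a<d. P a) \<longleftrightarrow> P 0 \<and> (\<forall>a<d - 1. P (Suc a))" for P :: "nat \<Rightarrow> bool"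
    using assms by (auto simp: less_diff_conv) (metis Suc_less_eq2 gr0_conv_Suc not_gr_zero)
  show ?thesis
    unfolding alternating_radon_partition_def affine_dependence_def mult.assoc sum_even_odd
    by (subst all) (auto simp: lifted_coord_def projection_def vec_first_def)
qed

lemma H_even_minus_H_odd:
  assumes "d \<ge> 1"
  shows "H_even d y c - H_odd d y c = height_sum d y (\<lambda>j. (-1) ^ j * c j)"
  using assms
  by (simp add: H_even_def H_odd_def height_sum_def mult.assoc sum_even_odd height_def lifted_coord_def)

text \<open>Dividing the absolute values of the coefficients by the sum of the even ones normalizes
  both sides at once, since the total sum is zero.\<close>

lemma radon_partition_of_dependence:
  assumes "d \<ge> 1" "affine_dependence d y e" "alternating_signs d e"
  obtains c s where "alternating_radon_partition d y c" "s > 0"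
    "H_even d y c - H_odd d y c = s * height_sum d y e"
proof
  define S where "S = (\<Sum>j | j \<le> d \<and> even j. (-1) ^ j * e j)"
  define c where "c j = (-1) ^ j * e j / S" for j
  have "S > 0"
    unfolding S_def using assms(3) by (intro sum_pos) (auto simp: alternating_signs_def)
  then show "1 / S > 0" by simp
  have ce: "(\<lambda>j. (-1) ^ j * c j) = (\<lambda>j. 1 / S * e j)"
    by (rule ext) (simp add: c_def flip: mult.assoc power_add)
  have "affine_dependence d y (\<lambda>j. 1 / S * e j)"
    using assms(2) unfolding affine_dependence_def mult.assoc sum_distrib_left[symmetric] by simp
  moreover have "\<forall>j\<le>d. c j > 0"
    using assms(3) \<open>S > 0\<close> by (simp add: c_def alternating_signs_def)
  moreover have "(\<Sum>j | j \<le> d \<and> even j. c j) = 1"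
    using \<open>S > 0\<close> unfolding c_def sum_divide_distrib[symmetric] S_def[symmetric] by simp
  ultimately show "alternating_radon_partition d y c"
    using assms(1) by (simp add: alternating_radon_partition_iff ce)
  show "H_even d y c - H_odd d y c = 1 / S * height_sum d y e"
    using assms(1) by (simp only: H_even_minus_H_odd ce) (rule height_sum_scale, simp)
qed

lemma dependence_of_radon_partition:
  assumes "d \<ge> 1" "alternating_radon_partition d y c"
  shows "affine_dependence d y (\<lambda>j. (-1) ^ j * c j)" "alternating_signs d (\<lambda>j. (-1) ^ j * c j)"
  using assms by (simp_all add: alternating_radon_partition_iff alternating_signs_def
      flip: mult.assoc power_add)

text \<open>The colors quantify existentially over Radon partitions; one exists, and all of them
  yield the sign of the height sum of \<open>e\<close>.\<close>

lemma color_iff_height_sum: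
  assumes "d \<ge> 1" "cyclic_tuple d y" "affine_dependence d y e" "alternating_signs d e"
  shows even_above_iff: "even_above d y \<longleftrightarrow> height_sum d y e > 0"
    and odd_above_iff: "odd_above d y \<longleftrightarrow> height_sum d y e < 0"
proof -
  have sgn: "sgn (H_even d y c - H_odd d y c) = sgn (height_sum d y e)"
    if "alternating_radon_partition d y c" for c
    using alternating_dependences_same_sign[OF assms(2) _ assms(3) _ assms(4)]
      dependence_of_radon_partition[OF assms(1) that] H_even_minus_H_odd[OF assms(1)] by simp
  obtain c s where c: "alternating_radon_partition d y c"
    using radon_partition_of_dependence[OF assms(1,3,4)] by metis
  show "even_above d y \<longleftrightarrow> height_sum d y e > 0"
    using sgn c unfolding even_above_def by (metis diff_gt_0_iff_gt sgn_greater)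
  show "odd_above d y \<longleftrightarrow> height_sum d y e < 0"
    using sgn c unfolding odd_above_def by (metis diff_less_0_iff_less sgn_less)
qed

section \<open>General position as a nonvanishing height sum\<close>

text \<open>A hyperplane with normal \<open>a\<close> and offset \<open>b\<close> is the relation
  with coefficients \<open>- b, a\<close> among the rows of the lifted matrix, heights
  included.\<close>

lemma hyperplane_iff_lifted_rows:
  assumes "\<forall>s\<le>d. y s \<in> carrier_vec d"
  shows "(\<exists>a\<in>carrier_vec d. \<exists>b. a \<noteq> 0\<^sub>v d \<and> (\<forall>s\<le>d. a \<bullet> y s = b)) \<longleftrightarrow>
    (\<exists>u. (\<exists>a\<le>d. u a \<noteq> 0) \<and> (\<forall>s\<le>d. (\<Sum>a\<le>d. u a * lifted_coord (y s) a) = 0))"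
proof -
  have eq: "(\<Sum>a\<le>d. u a * lifted_coord (y s) a) = u 0 + vec d (\<lambda>a. u (Suc a)) \<bullet> y s" if "s \<le> d" for u s
  proof -
    have "y s \<in> carrier_vec d" using assms that by blast
    then show ?thesis
      unfolding sum.atMost_shift by (auto simp: lifted_coord_def scalar_prod_def lessThan_atLeast0)
  qed
  show ?thesis
  proof
    assume "\<exists>a\<in>carrier_vec d. \<exists>b. a \<noteq> 0\<^sub>v d \<and> (\<forall>s\<le>d. a \<bullet> y s = b)"
    then obtain a b where ab: "a \<in> carrier_vec d" "a \<noteq> 0\<^sub>v d" "\<forall>s\<le>d. a \<bullet> y s = b" by blast
    define u where "u m = (if m = 0 then - b else a $ (m - 1))" for m
    have "vec d (\<lambda>a. u (Suc a)) = a" using ab(1) by (auto simp: u_def)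
    then have "\<forall>s\<le>d. (\<Sum>a\<le>d. u a * lifted_coord (y s) a) = 0"
      using ab(3) by (simp add: eq) (simp add: u_def)
    moreover obtain m where "m < d" "a $ m \<noteq> 0" using ab(1,2) by (auto simp: vec_eq_iff)
    then have "Suc m \<le> d \<and> u (Suc m) \<noteq> 0" by (simp add: u_def)
    ultimately show "\<exists>u. (\<exists>a\<le>d. u a \<noteq> 0) \<and> (\<forall>s\<le>d. (\<Sum>a\<le>d. u a * lifted_coord (y s) a) = 0)"
      by blast
  next
    assume "\<exists>u. (\<exists>a\<le>d. u a \<noteq> 0) \<and> (\<forall>s\<le>d. (\<Sum>a\<le>d. u a * lifted_coord (y s) a) = 0)"
    then obtain u m where u: "m \<le> d" "u m \<noteq> 0" "\<forall>s\<le>d. u 0 + vec d (\<lambda>a. u (Suc a)) \<bullet> y s = 0"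
      using eq by auto
    have y0: "y 0 \<in> carrier_vec d" using assms by simp
    \<comment> \<open>With a zero normal the offset would vanish too, so a nontrivial row relation
      has a nonzero normal.\<close>
    have "vec d (\<lambda>a. u (Suc a)) \<noteq> 0\<^sub>v d"
    proof
      assume 0: "vec d (\<lambda>a. u (Suc a)) = 0\<^sub>v d"
      then have "u 0 = 0" using u(3) y0 by auto
      moreover have "u (Suc a) = 0" if "a < d" for a
        using arg_cong[OF 0, of "\<lambda>v. v $ a"] that by simp
      ultimately show False using u(1,2) by (cases m) auto
    qed
    moreover have "\<forall>s\<le>d. vec d (\<lambda>a. u (Suc a)) \<bullet> y s = - u 0"
      using u(3) by (metis add.commute eq_neg_iff_add_eq_0)
    ultimately show "\<exists>a\<in>carrier_vec d. \<exists>b. a \<noteq> 0\<^sub>v d \<and> (\<forall>s\<le>d. a \<bullet> y s = b)"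
      by (intro bexI[of _ "vec d (\<lambda>a. u (Suc a))"] exI[of _ "- u 0"]) auto
  qed
qed

text \<open>Both sides say that the square lifted matrix is singular. A row relation paired with
  \<open>e\<close> leaves only the height row; conversely, if the height sum is zero,
  \<open>e\<close> is a kernel vector.\<close>

lemma hyperplane_iff_height_sum:
  assumes "\<forall>s\<le>d. y s \<in> carrier_vec d" "lifted_det d y \<noteq> 0" "affine_dependence d y e" "e d \<noteq> 0"
  shows "(\<exists>a\<in>carrier_vec d. \<exists>b. a \<noteq> 0\<^sub>v d \<and> (\<forall>s\<le>d. a \<bullet> y s = b)) \<longleftrightarrow> height_sum d y e = 0"
  unfolding hyperplane_iff_lifted_rows[OF assms(1)]
proof
  assume "\<exists>u. (\<exists>a\<le>d. u a \<noteq> 0) \<and> (\<forall>s\<le>d. (\<Sum>a\<le>d. u a * lifted_coord (y s) a) = 0)"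
  then obtain u where u: "\<exists>a\<le>d. u a \<noteq> 0" "\<forall>s\<le>d. (\<Sum>a\<le>d. u a * lifted_coord (y s) a) = 0" by blast
  have "0 = (\<Sum>s\<le>d. e s * (\<Sum>a\<le>d. u a * lifted_coord (y s) a))"
    using u(2) by simp
  also have "\<dots> = (\<Sum>a\<le>d. u a * (\<Sum>s\<le>d. e s * lifted_coord (y s) a))"
    unfolding sum_distrib_left by (subst sum.swap) (simp add: mult.left_commute)
  also have "\<dots> = u d * height_sum d y e"
    using assms(3) by (simp add: affine_dependence_def height_sum_def flip: lessThan_Suc_atMost)
  finally have prod: "u d * height_sum d y e = 0" by simp
  show "height_sum d y e = 0"
  proof (rule ccontr)
    assume "height_sum d y e \<noteq> 0"
    then have "u d = 0" using prod by simp
    \<comment> \<open>Without the height row, \<open>u\<close> is a row relation of the nonsingular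
      matrix behind \<open>lifted_det d y\<close>.\<close>
    then have "\<forall>s<d. (\<Sum>a<d. u a * lifted_coord (y s) a) = 0"
      using u(2) by (simp flip: lessThan_Suc_atMost)
    then have "\<forall>a<d. u a = 0"
      using assms(2) det_eq_0_iff_rows_dependent[of d "\<lambda>a s. lifted_coord (y s) a"]
      unfolding lifted_det_def by blast
    with \<open>u d = 0\<close> u(1) show False by (auto simp: le_less)
  qed
next
  assume "height_sum d y e = 0"
  then have "\<forall>a<Suc d. (\<Sum>s<Suc d. lifted_coord (y s) a * e s) = 0"
    using assms(3) by (auto simp: affine_dependence_def height_sum_def less_Suc_eq mult.commute
        simp flip: lessThan_Suc_atMost)
  then have "det (mat (Suc d) (Suc d) (\<lambda>(a, s). lifted_coord (y s) a)) = 0"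
    using det_eq_0_iff_columns_dependent[of "Suc d" "\<lambda>a s. lifted_coord (y s) a"] assms(4) by blast
  then show "\<exists>u. (\<exists>a\<le>d. u a \<noteq> 0) \<and> (\<forall>s\<le>d. (\<Sum>a\<le>d. u a * lifted_coord (y s) a) = 0)"
    using det_eq_0_iff_rows_dependent[of "Suc d" "\<lambda>a s. lifted_coord (y s) a"]
    by (simp only: lessThan_Suc_atMost less_Suc_eq_le)
qed

section \<open>The moment curve\<close>

lemma lifted_coord_moment_point:
  assumes "d \<ge> 1" "a \<le> d"
  shows "lifted_coord (moment_point d t h) a = (if a < d then t ^ a else h)"
  using assms by (auto simp: lifted_coord_def moment_point_def less_diff_conv)

text \<open>The lifted projections form Vandermonde matrices with increasing nodes.\<close>

lemma moment_curve_cyclic_projections: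
  assumes "d \<ge> 1" "strict_mono_on {..<N} t"
  shows "cyclic_projections d N (\<lambda>i. moment_point d (t i) (h i))"
  unfolding cyclic_projections_iff[OF assms(1)]
proof
  fix i assume i: "i \<in> increasing_tuples d {..<N}"
  have "lifted_det d ((\<lambda>i. moment_point d (t i) (h i)) \<circ> i) = det (mat d d (\<lambda>(a, s). (t \<circ> i) s ^ a))"
    unfolding lifted_det_def using assms(1)
    by (intro arg_cong[of _ _ det] eq_matI) (auto simp: lifted_coord_moment_point)
  also have "\<dots> > 0"
    using assms(2) i by (intro vandermonde_det_pos)
      (auto simp: strict_mono_on_def increasing_tuples_def image_subset_iff)
  finally show "lifted_det d ((\<lambda>i. moment_point d (t i) (h i)) \<circ> i) > 0" .
qed

text \<open>Exactly the \<open>d - j\<close> factors with \<open>r > j\<close> are negative.\<close>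

lemma lagrange_denominator_sign:
  fixes t :: "nat \<Rightarrow> 'a::linordered_field"
  assumes "strict_mono_on {..d} t" "j \<le> d"
  shows "(-1) ^ (d - j) * (\<Prod>r\<in>{..d} - {j}. t j - t r) > 0"
proof -
  have split: "{..d} - {j} = {..<j} \<union> {j<..d}" using assms(2) by auto
  have "(\<Prod>r\<in>{..d} - {j}. t j - t r) = (\<Prod>r<j. t j - t r) * (\<Prod>r\<in>{j<..d}. t j - t r)"
    unfolding split by (rule prod.union_disjoint) auto
  also have "(\<Prod>r\<in>{j<..d}. t j - t r) = (\<Prod>r\<in>{j<..d}. (-1) * (t r - t j))"
    by simp
  also have "\<dots> = (-1) ^ (d - j) * (\<Prod>r\<in>{j<..d}. t r - t j)"
    by (subst prod.distrib) simp
  finally have "(-1) ^ (d - j) * (\<Prod>r\<in>{..d} - {j}. t j - t r) =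
      (\<Prod>r<j. t j - t r) * (\<Prod>r\<in>{j<..d}. t r - t j)"
    by (simp add: minus_one_power_iff)
  also have "\<dots> > 0"
    using assms by (intro mult_pos_pos prod_pos) (auto simp: strict_mono_on_def)
  finally show ?thesis .
qed

lemma moment_curve_dependence:
  assumes "d \<ge> 1" "strict_mono_on {..d} (\<lambda>j. fst (q j))"
    and y: "\<And>j. j \<le> d \<Longrightarrow> y j = moment_point d (fst (q j)) (snd (q j))"
  obtains e where "affine_dependence d y e" "alternating_signs d e"
    "height_sum d y e = (-1) ^ d * divided_difference d q"
proof
  define t where "t j = fst (q j)" for j
  have t: "strict_mono_on {..d} t" using assms(2) by (simp add: t_def[abs_def])
  \<comment> \<open>The Lagrange weight at \<open>j\<close> has sign \<open>(-1) ^ (d - j)\<close>;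
    the factor \<open>(-1) ^ d\<close> normalizes it to \<open>(-1) ^ j\<close>.\<close>
  define e where "e j = (-1) ^ d / (\<Prod>r\<in>{..d} - {j}. t j - t r)" for j
  show "alternating_signs d e"
    unfolding alternating_signs_def
  proof (intro allI impI)
    fix j assume "j \<le> d"
    have "(-1) ^ j * e j = (-1) ^ (d - j) / (\<Prod>r\<in>{..d} - {j}. t j - t r)"
      using \<open>j \<le> d\<close> by (simp add: e_def minus_one_power_iff)
    moreover have "(-1) ^ (d - j) * (\<Prod>r\<in>{..d} - {j}. t j - t r) > 0"
      by (rule lagrange_denominator_sign[OF t \<open>j \<le> d\<close>])
    ultimately show "(-1) ^ j * e j > 0"
      by (simp add: zero_less_divide_iff zero_less_mult_iff)
  qed
  show "affine_dependence d y e"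
    unfolding affine_dependence_def
  proof (intro allI impI)
    fix a assume "a < d"
    have "(\<Sum>j\<le>d. e j * lifted_coord (y j) a) =
        (-1) ^ d * (\<Sum>j\<le>d. t j ^ a / (\<Prod>r\<in>{..d} - {j}. t j - t r))"
      unfolding sum_distrib_left using assms(1) \<open>a < d\<close>
      by (intro sum.cong) (auto simp: y lifted_coord_moment_point e_def t_def)
    also have "\<dots> = 0"
      using lagrange_weights_annihilate_powers[OF strict_mono_on_imp_inj_on[OF t] \<open>a < d\<close>] by simp
    finally show "(\<Sum>j\<le>d. e j * lifted_coord (y j) a) = 0" .
  qed
  show "height_sum d y e = (-1) ^ d * divided_difference d q"
    unfolding height_sum_def divided_difference_def sum_distrib_left using assms(1)
    by (intro sum.cong) (auto simp: y lifted_coord_moment_point e_def t_def)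
qed

lemma moment_curve_tuple:
  fixes d :: nat and p :: "nat \<Rightarrow> real \<times> real"
  defines "x \<equiv> \<lambda>i. moment_point d (fst (p i)) (snd (p i))"
  assumes "d \<ge> 1" "strict_mono_on {..<N} (\<lambda>i. fst (p i))" "i \<in> increasing_tuples (d + 1) {..<N}"
  shows moment_curve_even_above:
      "even_above d (x \<circ> i) \<longleftrightarrow> (-1) ^ d * divided_difference d (p \<circ> i) > 0"
    and moment_curve_odd_above:
      "odd_above d (x \<circ> i) \<longleftrightarrow> (-1) ^ d * divided_difference d (p \<circ> i) < 0"
    and moment_curve_hyperplane:
      "(\<exists>a\<in>carrier_vec d. \<exists>b. a \<noteq> 0\<^sub>v d \<and> (\<forall>s\<le>d. a \<bullet> x (i s) = b)) \<longleftrightarrow>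
        divided_difference d (p \<circ> i) = 0"
proof -
  have cyc: "cyclic_tuple d (x \<circ> i)"
    using assms moment_curve_cyclic_projections[OF assms(2,3)]
    by (intro cyclic_projections_imp_cyclic_tuple) auto
  have mono: "strict_mono_on {..d} (\<lambda>j. fst ((p \<circ> i) j))"
    using assms(3,4) by (auto simp: strict_mono_on_def increasing_tuples_def image_subset_iff)
  have "(x \<circ> i) j = moment_point d (fst ((p \<circ> i) j)) (snd ((p \<circ> i) j))" for j
    by (simp add: x_def)
  then obtain e where e: "affine_dependence d (x \<circ> i) e" "alternating_signs d e"
    "height_sum d (x \<circ> i) e = (-1) ^ d * divided_difference d (p \<circ> i)"
    using moment_curve_dependence[OF assms(2) mono] by blast
  show "even_above d (x \<circ> i) \<longleftrightarrow> (-1) ^ d * divided_difference d (p \<circ> i) > 0"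
    and "odd_above d (x \<circ> i) \<longleftrightarrow> (-1) ^ d * divided_difference d (p \<circ> i) < 0"
    using color_iff_height_sum[OF assms(2) cyc e(1,2)] e(3) by simp_all
  show "(\<exists>a\<in>carrier_vec d. \<exists>b. a \<noteq> 0\<^sub>v d \<and> (\<forall>s\<le>d. a \<bullet> x (i s) = b)) \<longleftrightarrow>
      divided_difference d (p \<circ> i) = 0"
    using hyperplane_iff_height_sum[of d "x \<circ> i" e] cyclic_tuple_det_pos[OF cyc] e
      alternating_signs_nonzero[OF e(2)] by (simp add: x_def moment_point_def)
qed

text \<open>Planar points \<open>(t, h)\<close> and points \<open>moment_point d t h\<close> carry
  the same data, and this correspondence preserves general position and homogeneous sets.\<close>

lemma EM_property_iff_AB_mc_property:
  assumes "d \<ge> 1"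
  shows "EM_property d k N \<longleftrightarrow> AB_mc_property d k N"
proof -
  define x where "x p i = moment_point d (fst (p i)) (snd (p i))" for p :: "nat \<Rightarrow> real \<times> real" and i
  have homogeneous: "AB_homogeneous d (x p) S \<longleftrightarrow> EM_homogeneous d p S"
    if "strict_mono_on {..<N} (\<lambda>i. fst (p i))" "S \<in> [{..<N}]\<^bsup>k\<^esup>" for p S
  proof -
    have "i \<in> increasing_tuples (d + 1) {..<N}" if "i \<in> increasing_tuples (d + 1) S" for i
      using that \<open>S \<in> [{..<N}]\<^bsup>k\<^esup>\<close> by (auto simp: increasing_tuples_def nsets_def)
    \<comment> \<open>For odd \<open>d\<close> the global sign exchanges the two alternatives of
      homogeneity.\<close>
    then show ?thesis
      unfolding AB_homogeneous_def EM_homogeneous_def x_def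
      using moment_curve_even_above[OF assms that(1)] moment_curve_odd_above[OF assms that(1)]
      by (cases "even d") auto
  qed
  have general: "general_position d N (x p) \<longleftrightarrow> d_general_position d N p"
    if "strict_mono_on {..<N} (\<lambda>i. fst (p i))" for p
    unfolding general_position_def d_general_position_def x_def
    using moment_curve_hyperplane[OF assms that] by simp
  have "AB_mc_property d k N \<longleftrightarrow> (\<forall>p. strict_mono_on {..<N} (\<lambda>i. fst (p i)) \<and>
      general_position d N (x p) \<longrightarrow> (\<exists>S \<in> [{..<N}]\<^bsup>k\<^esup>. AB_homogeneous d (x p) S))"
  proof
    assume "AB_mc_property d k N"
    then have "strict_mono_on {..<N} (\<lambda>i. fst (p i)) \<and> general_position d N (x p) \<longrightarrow>
        (\<exists>S \<in> [{..<N}]\<^bsup>k\<^esup>. AB_homogeneous d (x p) S)" for p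
      unfolding AB_mc_property_def x_def[abs_def]
      by (elim allE[of _ "\<lambda>i. fst (p i)"] allE[of _ "\<lambda>i. snd (p i)"])
    then show "\<forall>p. strict_mono_on {..<N} (\<lambda>i. fst (p i)) \<and>
        general_position d N (x p) \<longrightarrow> (\<exists>S \<in> [{..<N}]\<^bsup>k\<^esup>. AB_homogeneous d (x p) S)"
      by blast
  next
    assume *: "\<forall>p. strict_mono_on {..<N} (\<lambda>i. fst (p i)) \<and>
        general_position d N (x p) \<longrightarrow> (\<exists>S \<in> [{..<N}]\<^bsup>k\<^esup>. AB_homogeneous d (x p) S)"
    show "AB_mc_property d k N"
      unfolding AB_mc_property_def
    proof (intro allI)
      fix t h
      show "strict_mono_on {..<N} t \<and> general_position d N (\<lambda>i. moment_point d (t i) (h i)) \<longrightarrow>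
          (\<exists>S \<in> [{..<N}]\<^bsup>k\<^esup>. AB_homogeneous d (\<lambda>i. moment_point d (t i) (h i)) S)"
        using *[rule_format, of "\<lambda>i. (t i, h i)"] by (simp add: x_def[abs_def])
    qed
  qed
  then show ?thesis
    unfolding EM_property_def using homogeneous general by blast
qed

text \<open>Sequences over the moment curve are among those with cyclic projections.\<close>

lemma AB_property_imp_AB_mc_property:
  assumes "d \<ge> 1" "AB_property d k N"
  shows "AB_mc_property d k N"
  unfolding AB_mc_property_def
proof (intro allI impI)
  fix t h
  assume "strict_mono_on {..<N} t \<and> general_position d N (\<lambda>i. moment_point d (t i) (h i))"
  then show "\<exists>S \<in> [{..<N}]\<^bsup>k\<^esup>. AB_homogeneous d (\<lambda>i. moment_point d (t i) (h i)) S"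
    using assms(2) moment_curve_cyclic_projections[OF assms(1), of N t h]
    unfolding AB_property_def
    by (elim allE[of _ "\<lambda>i. moment_point d (t i) (h i)"]) (auto simp: moment_point_def)
qed

section \<open>Monotonicity of the above--below coloring\<close>

lemma sum_insert_index:
  assumes "j \<le> Suc d"
  shows "(\<Sum>m\<le>d. g (insert_index j m)) = (\<Sum>m\<in>{..Suc d} - {j}. g m)"
proof -
  have "insert_index j ` {..d} = {..Suc d} - {j}"
    using insert_index_image[of j "Suc d"] assms by (simp add: atLeast0LessThan lessThan_Suc_atMost)
  then show ?thesis
    using sum.reindex[of "insert_index j" "{..d}" g] insert_index_inj_on by auto
qed

text \<open>The dependence supported off \<open>q\<close> is unique up to scaling, so it is proportional to the
  combination of the other two that vanishes at \<open>q\<close>. By alternation that combination has positive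
  coefficients, and comparing the entries at \<open>r\<close> shows that the scaling factor is positive.\<close>

lemma middle_height_sum_sign:
  assumes pqr: "p < q" "q < r" "r \<le> Suc d"
    and det: "lifted_det d (y \<circ> insert_index q) \<noteq> 0"
    and dep: "\<And>j. j \<in> {p, q, r} \<Longrightarrow> affine_dependence d (y \<circ> insert_index j) (e j)"
    and alt: "\<And>j. j \<in> {p, q, r} \<Longrightarrow> alternating_signs d (e j)"
  obtains A B where "A > 0" "B > 0"
    "height_sum d (y \<circ> insert_index q) (e q) =
      A * height_sum d (y \<circ> insert_index p) (e p) + B * height_sum d (y \<circ> insert_index r) (e r)"
proof -
  obtain q' where q: "q = Suc q'" using pqr by (cases q) auto
  obtain r' where r: "r = Suc r'" using pqr by (cases r) auto
  \<comment> \<open>Extension by zero at the omitted point makes dependences omitting different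
    points addable, as functions on all \<open>d + 2\<close> points.\<close>
  define ext where "ext j m = (if m = j then 0 else e j (delete_index j m))" for j m
  have ext_sum: "(\<Sum>m\<le>Suc d. ext j m * w m) = (\<Sum>m\<le>d. e j m * w (insert_index j m))"
    if "j \<le> Suc d" for j and w :: "nat \<Rightarrow> real"
  proof -
    have "(\<Sum>m\<le>Suc d. ext j m * w m) = (\<Sum>m\<in>{..Suc d} - {j}. ext j m * w m)"
      using that by (subst sum.remove[of _ j]) (auto simp: ext_def)
    also have "\<dots> = (\<Sum>m\<le>d. ext j (insert_index j m) * w (insert_index j m))"
      using that by (rule sum_insert_index[symmetric])
    also have "\<dots> = (\<Sum>m\<le>d. e j m * w (insert_index j m))"
      by (rule sum.cong) (auto simp: ext_def insert_index_def delete_index_def)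
    finally show ?thesis .
  qed
  \<comment> \<open>The weights cancel the entries at \<open>q\<close>: this point has position
    \<open>q\<close> in the tuple omitting \<open>r\<close> but \<open>q'\<close> in the tuple
    omitting \<open>p\<close>. The opposite signs there make both weights positive.\<close>
  define A where "A = (-1) ^ q * e r q"
  define B where "B = (-1) ^ q' * e p q'"
  have "A > 0" using alt[of r] pqr by (simp add: A_def alternating_signs_def)
  have "B > 0" using alt[of p] pqr q by (simp add: B_def alternating_signs_def)
  define g where "g m = A * ext p m + B * ext r m" for m
  have "g q = 0"
    using pqr q by (simp add: g_def ext_def delete_index_def A_def B_def)
  have g_sum: "(\<Sum>m\<le>d. (g \<circ> insert_index q) m * w (insert_index q m)) =
      A * (\<Sum>m\<le>d. e p m * w (insert_index p m)) + B * (\<Sum>m\<le>d. e r m * w (insert_index r m))" for w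
  proof -
    have "(\<Sum>m\<le>d. (g \<circ> insert_index q) m * w (insert_index q m)) = (\<Sum>m\<in>{..Suc d} - {q}. g m * w m)"
      using sum_insert_index[of q d "\<lambda>m. g m * w m"] pqr by simp
    also have "\<dots> = (\<Sum>m\<le>Suc d. g m * w m)"
      using \<open>g q = 0\<close> pqr by (subst (2) sum.remove[of _ q]) auto
    also have "\<dots> = A * (\<Sum>m\<le>Suc d. ext p m * w m) + B * (\<Sum>m\<le>Suc d. ext r m * w m)"
      by (simp only: g_def sum_distrib_left distrib_right sum.distrib mult.assoc)
    also have "\<dots> = A * (\<Sum>m\<le>d. e p m * w (insert_index p m)) +
        B * (\<Sum>m\<le>d. e r m * w (insert_index r m))"
      using pqr by (subst (1 2) ext_sum) auto
    finally show ?thesis .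
  qed
  have "affine_dependence d (y \<circ> insert_index q) (g \<circ> insert_index q)"
    using dep[of p] dep[of r] g_sum[of "\<lambda>m. lifted_coord (y m) _"]
    by (simp add: affine_dependence_def)
  moreover have "e q d \<noteq> 0" using alt[of q] by (simp add: alternating_signs_nonzero)
  ultimately obtain s where s: "\<forall>m\<le>d. (g \<circ> insert_index q) m = s * e q m"
    using affine_dependence_unique[OF det _ dep[of q]] by blast
  \<comment> \<open>Point \<open>r\<close> has position \<open>r'\<close> once \<open>p\<close> or
    \<open>q\<close> is omitted, and \<open>ext r\<close> vanishes at it, so only \<open>e p\<close>
    contributes.\<close>
  have "(g \<circ> insert_index q) r' = A * e p r'"
    using pqr r by (simp add: g_def ext_def insert_index_def delete_index_def)
  moreover have "(g \<circ> insert_index q) r' = s * e q r'"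
    using s pqr r by blast
  ultimately have "s * ((-1) ^ r' * e q r') = A * ((-1) ^ r' * e p r')"
    by (simp add: mult.left_commute)
  moreover have "(-1) ^ r' * e q r' > 0" "(-1) ^ r' * e p r' > 0"
    using alt[of q] alt[of p] pqr r by (auto simp: alternating_signs_def)
  ultimately have "s > 0"
    using \<open>A > 0\<close> by (metis mult_pos_pos zero_less_mult_pos2)
  have "s * height_sum d (y \<circ> insert_index q) (e q) =
      A * height_sum d (y \<circ> insert_index p) (e p) + B * height_sum d (y \<circ> insert_index r) (e r)"
    using height_sum_scale[OF s, of "y \<circ> insert_index q"] g_sum[of "\<lambda>m. lifted_coord (y m) d"]
    by (simp add: height_sum_def)
  then have "height_sum d (y \<circ> insert_index q) (e q) =
      A / s * height_sum d (y \<circ> insert_index p) (e p) + B / s * height_sum d (y \<circ> insert_index r) (e r)"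
    using \<open>s > 0\<close> by (simp add: field_simps)
  with \<open>A > 0\<close> \<open>B > 0\<close> \<open>s > 0\<close> show ?thesis by (intro that[of "A / s" "B / s"]) auto
qed

section \<open>Omitting one element, lexicographic order and sign changes\<close>

lemma sorted_list_of_set_image_increasing:
  fixes i :: "nat \<Rightarrow> 'a::linorder"
  assumes "strict_mono_on {..<m} i"
  shows "sorted_list_of_set (i ` {..<m}) = map i [0..<m]"
proof -
  have "sorted_wrt (<) (map i [0..<m])"
    using assms by (auto simp: sorted_wrt_map sorted_wrt_iff_nth_less strict_mono_on_def)
  moreover have "set (map i [0..<m]) = i ` {..<m}" by (simp add: lessThan_atLeast0)
  ultimately show ?thesis
    by (metis sorted_list_of_set.idem_if_sorted_distinct strict_sorted_iff)
qed

lemma nth_sorted_list_of_set_increasing: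
  assumes "finite J" "card J = m" "J \<subseteq> S"
  shows "(!) (sorted_list_of_set J) \<in> increasing_tuples m S"
proof -
  have "sorted_wrt (<) (sorted_list_of_set J)" "length (sorted_list_of_set J) = m"
    using assms by auto
  moreover have "sorted_list_of_set J ! s \<in> S" if "s < m" for s
    using assms that nth_mem[of s "sorted_list_of_set J"] by auto
  ultimately show ?thesis
    by (auto simp: increasing_tuples_def strict_mono_on_def sorted_wrt_iff_nth_less)
qed

definition omit_nth :: "nat \<Rightarrow> 'a list \<Rightarrow> 'a list" where
  "omit_nth j xs = take j xs @ drop (Suc j) xs"

lemma nth_omit_nth: "j < length xs \<Longrightarrow> omit_nth j xs ! m = xs ! insert_index j m"
  by (auto simp: omit_nth_def nth_append insert_index_def min_def)

lemma sorted_omit_nth: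
  assumes "sorted_wrt P xs"
  shows "sorted_wrt P (omit_nth j xs)"
proof -
  have "sorted_wrt P (take j xs @ drop j xs)" using assms by simp
  moreover have "set (drop (Suc j) xs) \<subseteq> set (drop j xs)" by (simp add: set_drop_subset_set_drop)
  ultimately show ?thesis
    using assms unfolding omit_nth_def sorted_wrt_append by (auto intro: sorted_wrt_drop)
qed

lemma set_omit_nth:
  assumes "distinct xs" "j < length xs"
  shows "set (omit_nth j xs) = set xs - {xs ! j}"
proof -
  have "xs = take j xs @ xs ! j # drop (Suc j) xs" using assms(2) by (rule id_take_nth_drop)
  then have "distinct (take j xs @ xs ! j # drop (Suc j) xs)"
    "set xs = set (take j xs @ xs ! j # drop (Suc j) xs)"
    using assms(1) by metis+
  then show ?thesis unfolding omit_nth_def by auto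
qed

text \<open>The lists agree before position \<open>p\<close>; there the first still has
  \<open>xs ! p\<close>, the second already the larger \<open>xs ! Suc p\<close>.\<close>

lemma omit_nth_lex_less:
  fixes xs :: "'a::linorder list"
  assumes "sorted_wrt (<) xs" "p < q" "q < length xs"
  shows "omit_nth q xs < omit_nth p xs"
proof -
  have "take q xs = take p xs @ xs ! p # drop (Suc p) (take q xs)"
    using id_take_nth_drop[of p "take q xs"] assms by (simp add: min_def)
  then have 1: "omit_nth q xs = take p xs @ xs ! p # drop (Suc p) (take q xs) @ drop (Suc q) xs"
    unfolding omit_nth_def by simp
  have 2: "omit_nth p xs = take p xs @ xs ! Suc p # drop (Suc (Suc p)) xs"
    using assms by (simp add: omit_nth_def Cons_nth_drop_Suc)
  have "xs ! p < xs ! Suc p" using assms by (simp add: sorted_wrt_iff_nth_less)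
  then show ?thesis
    unfolding 1 2 list_less_def by (intro lexord_append_leftI) simp
qed

lemma sorted_list_of_set_omit_nth:
  assumes "finite J" "j < card J"
  shows "sorted_list_of_set (set (omit_nth j (sorted_list_of_set J))) = omit_nth j (sorted_list_of_set J)"
  using sorted_omit_nth[of "(<)" "sorted_list_of_set J" j]
  by (metis sorted_list_of_set.idem_if_sorted_distinct strict_sorted_iff strict_sorted_list_of_set)

text \<open>Lexicographically, the subset omitting the largest element comes first.\<close>

lemma lex_subsets_codim_one:
  assumes "finite J" "card J = Suc r"
  shows "lex_subsets r J = map (\<lambda>m. omit_nth (r - m) (sorted_list_of_set J)) [0..<Suc r]"
proof -
  let ?js = "sorted_list_of_set J"
  let ?L = "map (\<lambda>m. omit_nth (r - m) ?js) [0..<Suc r]"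
  have len: "length ?js = Suc r" using assms by simp
  have "sorted_wrt (<) ?L"
    unfolding sorted_wrt_map sorted_wrt_iff_nth_less
    using len by (auto intro!: omit_nth_lex_less simp del: upt_Suc)
  moreover have "set ?L = sorted_list_of_set ` [J]\<^bsup>r\<^esup>"
  proof (intro equalityI subsetI)
    fix l assume "l \<in> set ?L"
    then obtain m where m: "m < Suc r" "l = omit_nth (r - m) ?js" by (auto simp del: upt_Suc)
    have "set l = J - {?js ! (r - m)}" "?js ! (r - m) \<in> J"
      using m assms len set_omit_nth[of ?js "r - m"] nth_mem[of "r - m" ?js] by auto
    then have "set l \<in> [J]\<^bsup>r\<^esup>" using assms by (auto simp: nsets_def card_Diff_singleton)
    moreover have "l = sorted_list_of_set (set l)"
      using sorted_list_of_set_omit_nth[of J "r - m"] m assms by simp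
    ultimately show "l \<in> sorted_list_of_set ` [J]\<^bsup>r\<^esup>" by blast
  next
    fix l assume "l \<in> sorted_list_of_set ` [J]\<^bsup>r\<^esup>"
    then obtain T where T: "T \<subseteq> J" "card T = r" "l = sorted_list_of_set T" by (auto simp: nsets_def)
    have "card (J - T) = 1"
      using assms T by (subst card_Diff_subset) (auto intro: finite_subset)
    then obtain v where v: "J - T = {v}" by (auto simp: card_1_singleton_iff)
    then have "v \<in> set ?js" using assms by auto
    then obtain j where j: "j < Suc r" "?js ! j = v" using len by (metis in_set_conv_nth)
    have "set (omit_nth j ?js) = T"
      using set_omit_nth[of ?js j] j len assms v T by auto
    then have "l = omit_nth (r - (r - j)) ?js"
      using sorted_list_of_set_omit_nth[of J j] j assms T by simp
    then show "l \<in> set ?L" using j by (auto simp del: upt_Suc intro!: image_eqI[of _ _ "r - j"])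
  qed
  ultimately show ?thesis
    unfolding lex_subsets_def by (metis sorted_list_of_set.idem_if_sorted_distinct strict_sorted_iff)
qed

text \<open>Given changes at \<open>s < s'\<close>, one of the entries at \<open>s'\<close> and
  \<open>Suc s'\<close> repeats the color at \<open>s\<close>, while the entry at
  \<open>Suc s\<close> in between differs.\<close>

lemma sign_changes_le_1:
  assumes "\<And>a b c. a < b \<Longrightarrow> b < c \<Longrightarrow> c < length cs \<Longrightarrow> cs ! a = cs ! c \<Longrightarrow> cs ! b = cs ! a"
  shows "sign_changes cs \<le> 1"
proof -
  have le: "s' \<le> s" if "Suc s < length cs" "cs ! s \<noteq> cs ! Suc s"
    "Suc s' < length cs" "cs ! s' \<noteq> cs ! Suc s'" for s s'
  proof (rule ccontr)
    assume "\<not> s' \<le> s"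
    then have "s < s'" by simp
    have 1: "cs ! Suc s' \<noteq> cs ! s"
      using assms[of s "Suc s" "Suc s'"] that \<open>s < s'\<close> by auto
    then have "cs ! s' = cs ! s" using that by blast
    moreover have "s' \<noteq> Suc s" using calculation that by auto
    ultimately show False
      using assms[of s "Suc s" s'] that \<open>s < s'\<close> by auto
  qed
  have fin: "finite {s. Suc s < length cs \<and> cs ! s \<noteq> cs ! Suc s}"
    by (rule finite_subset[of _ "{..<length cs}"]) auto
  show ?thesis
    unfolding sign_changes_def One_nat_def card_le_Suc0_iff_eq[OF fin]
    using le by (auto intro: order.antisym)
qed

section \<open>The induced coloring of index sets\<close>

text \<open>Used for tuples read off lists of length \<open>d + 1\<close>, where agreement is known
  only up to index \<open>d\<close>.\<close>

lemma even_above_cong: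
  assumes "\<And>j. j \<le> d \<Longrightarrow> y j = z j"
  shows "even_above d y \<longleftrightarrow> even_above d z"
proof -
  have "alternating_radon_partition d y c \<longleftrightarrow> alternating_radon_partition d z c"
    "H_even d y c = H_even d z c" "H_odd d y c = H_odd d z c" for c
    unfolding alternating_radon_partition_def H_even_def H_odd_def using assms
    by (auto intro!: sum.cong arg_cong2[of _ _ _ _ "(\<and>)"] all_cong arg_cong2[of _ _ _ _ "(=)"])
  then show ?thesis by (simp add: even_above_def)
qed

lemma general_position_height_sum:
  assumes "d \<ge> 1" "\<forall>i<N. x i \<in> carrier_vec d" "general_position d N x" "cyclic_projections d N x"
    and i: "i \<in> increasing_tuples (d + 1) {..<N}"
    and e: "affine_dependence d (x \<circ> i) e" "alternating_signs d e"
  shows "height_sum d (x \<circ> i) e \<noteq> 0"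
proof -
  have cyc: "cyclic_tuple d (x \<circ> i)"
    using assms by (intro cyclic_projections_imp_cyclic_tuple) auto
  have "\<forall>s\<le>d. (x \<circ> i) s \<in> carrier_vec d"
    using assms(2) i by (auto simp: increasing_tuples_def image_subset_iff)
  moreover have "\<not> (\<exists>a\<in>carrier_vec d. \<exists>b. a \<noteq> 0\<^sub>v d \<and> (\<forall>s\<le>d. a \<bullet> (x \<circ> i) s = b))"
    using assms(3) i by (simp add: general_position_def)
  moreover have "lifted_det d (x \<circ> i) \<noteq> 0" "e d \<noteq> 0"
    using cyclic_tuple_det_pos[OF cyc] alternating_signs_nonzero[OF e(2), of d] by simp_all
  ultimately show ?thesis
    using hyperplane_iff_height_sum[of d "x \<circ> i" e] e(1) by blast
qed

text \<open>A set is colored through its increasing enumeration. \<open>False\<close> amounts to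
  \<open>odd_above\<close> once general position and cyclic projections are given.\<close>

definition above_below_coloring :: "nat \<Rightarrow> (nat \<Rightarrow> real vec) \<Rightarrow> nat set \<Rightarrow> bool" where
  "above_below_coloring d x T \<longleftrightarrow> even_above d (x \<circ> (!) (sorted_list_of_set T))"

lemma above_below_coloring_monotone:
  assumes "d \<ge> 1" "\<forall>i<N. x i \<in> carrier_vec d" "general_position d N x" "cyclic_projections d N x"
  shows "monotone_coloring (d + 1) N (above_below_coloring d x)"
  unfolding monotone_coloring_def
proof
  fix J assume "J \<in> [{..<N}]\<^bsup>(d + 1 + 1)\<^esup>"
  then have J: "finite J" "card J = Suc (Suc d)" "J \<subseteq> {..<N}" by (auto simp: nsets_def)
  let ?js = "sorted_list_of_set J"
  define y where "y = x \<circ> (!) ?js"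
  have inc: "(!) ?js \<in> increasing_tuples (Suc (Suc d)) {..<N}"
    using J by (rule nth_sorted_list_of_set_increasing)
  have inc': "(!) ?js \<circ> insert_index j \<in> increasing_tuples (d + 1) {..<N}" if "j \<le> Suc d" for j
    using increasing_tuples_insert_index[OF inc that] by simp
  have cyc: "cyclic_tuple d (y \<circ> insert_index j)" if "j \<le> Suc d" for j
    using cyclic_projections_imp_cyclic_tuple[OF assms(1,4)] inc'[OF that]
    by (simp add: y_def comp_assoc)
  have "\<exists>e. j \<le> Suc d \<longrightarrow> affine_dependence d (y \<circ> insert_index j) e \<and> alternating_signs d e" for j
    using cyclic_tuple_dependence[OF cyc] by blast
  then obtain e where e: "\<And>j. j \<le> Suc d \<Longrightarrow> affine_dependence d (y \<circ> insert_index j) (e j)"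
    "\<And>j. j \<le> Suc d \<Longrightarrow> alternating_signs d (e j)" by metis
  define F where "F j = height_sum d (y \<circ> insert_index j) (e j)" for j
  have F0: "F j \<noteq> 0" if "j \<le> Suc d" for j
    using general_position_height_sum[OF assms inc'[OF that]] e[OF that]
    by (simp add: F_def y_def comp_assoc)
  have color: "above_below_coloring d x (set (omit_nth j ?js)) \<longleftrightarrow> F j > 0" if "j \<le> Suc d" for j
  proof -
    have "above_below_coloring d x (set (omit_nth j ?js)) \<longleftrightarrow> even_above d (y \<circ> insert_index j)"
      unfolding above_below_coloring_def using sorted_list_of_set_omit_nth[of J j] J that
      by (intro even_above_cong) (simp add: nth_omit_nth y_def)
    then show ?thesis
      using even_above_iff[OF assms(1) cyc[OF that] e[OF that]] by (simp add: F_def)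
  qed
  \<comment> \<open>\<open>F q\<close> is a positive combination of \<open>F p\<close> and
    \<open>F r\<close>, so equal outer signs force the middle one.\<close>
  have middle: "F q > 0 \<longleftrightarrow> F p > 0" if pqr: "p < q" "q < r" "r \<le> Suc d" "F p > 0 \<longleftrightarrow> F r > 0" for p q r
  proof -
    have det: "lifted_det d (y \<circ> insert_index q) \<noteq> 0"
      using cyclic_tuple_det_pos[OF cyc[of q]] pqr by simp
    have "affine_dependence d (y \<circ> insert_index j) (e j)" "alternating_signs d (e j)"
      if "j \<in> {p, q, r}" for j
      using that pqr e by auto
    then obtain A B where AB: "A > 0" "B > 0" "F q = A * F p + B * F r"
      using middle_height_sum_sign[OF pqr(1-3) det] unfolding F_def by blast
    show ?thesis
    proof (cases "F p > 0")
      case True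
      then show ?thesis using AB pqr(4) by (simp add: add_pos_pos)
    next
      case False
      then have "F p < 0" "F r < 0" using F0[of p] F0[of r] pqr by auto
      then have "F q < 0" unfolding AB(3) using AB(1,2) by (intro add_neg_neg mult_pos_neg)
      with False show ?thesis by simp
    qed
  qed
  \<comment> \<open>Entry \<open>m\<close> of the lexicographic list omits position
    \<open>Suc d - m\<close>, so the order of omitted positions is reversed.\<close>
  have eq: "map (\<lambda>l. above_below_coloring d x (set l)) (lex_subsets (d + 1) J) =
      map (\<lambda>m. F (Suc d - m) > 0) [0..<Suc (Suc d)]"
    using lex_subsets_codim_one[of J "Suc d"] J color by (simp del: upt_Suc)
  show "sign_changes (map (\<lambda>l. above_below_coloring d x (set l)) (lex_subsets (d + 1) J)) \<le> 1"
    unfolding eq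
  proof (rule sign_changes_le_1)
    fix a b c
    assume abc: "a < b" "b < c" "c < length (map (\<lambda>m. F (Suc d - m) > 0) [0..<Suc (Suc d)])"
      "map (\<lambda>m. F (Suc d - m) > 0) [0..<Suc (Suc d)] ! a =
       map (\<lambda>m. F (Suc d - m) > 0) [0..<Suc (Suc d)] ! c"
    then show "map (\<lambda>m. F (Suc d - m) > 0) [0..<Suc (Suc d)] ! b =
        map (\<lambda>m. F (Suc d - m) > 0) [0..<Suc (Suc d)] ! a"
      using middle[of "Suc d - c" "Suc d - b" "Suc d - a"] by (auto simp del: upt_Suc)
  qed
qed

text \<open>A monochromatic set of the induced monotone coloring is homogeneous for the above-below
  colors.\<close>

lemma R_mon_property_imp_AB_property:
  assumes "d \<ge> 1" "R_mon_property k (d + 1) N"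
  shows "AB_property d k N"
  unfolding AB_property_def
proof (intro allI impI)
  fix x assume "(\<forall>i<N. x i \<in> carrier_vec d) \<and> general_position d N x \<and> cyclic_projections d N x"
  then have x: "\<forall>i<N. x i \<in> carrier_vec d" "general_position d N x" "cyclic_projections d N x" by auto
  obtain S c where S: "S \<in> [{..<N}]\<^bsup>k\<^esup>"
    and c: "\<And>T. T \<in> [S]\<^bsup>(d + 1)\<^esup> \<Longrightarrow> above_below_coloring d x T = c"
    using assms(2) above_below_coloring_monotone[OF assms(1) x] unfolding R_mon_property_def by blast
  have even: "even_above d (x \<circ> i) \<longleftrightarrow> c" if "i \<in> increasing_tuples (d + 1) S" for i
  proof -
    have i: "strict_mono_on {..<d + 1} i" "i ` {..<d + 1} \<subseteq> S"
      using that by (auto simp: increasing_tuples_def)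
    then have "i ` {..<d + 1} \<in> [S]\<^bsup>(d + 1)\<^esup>"
      using strict_mono_on_imp_inj_on[OF i(1)] by (auto simp: nsets_def card_image)
    then have "above_below_coloring d x (i ` {..<d + 1}) \<longleftrightarrow> c" by (rule c)
    moreover have "above_below_coloring d x (i ` {..<d + 1}) \<longleftrightarrow> even_above d (x \<circ> i)"
      unfolding above_below_coloring_def sorted_list_of_set_image_increasing[OF i(1)]
      by (intro even_above_cong) (simp del: upt_Suc)
    ultimately show ?thesis by simp
  qed
  \<comment> \<open>The color \<open>False\<close> only denies \<open>even_above\<close>; a nonzero
    height sum upgrades this to \<open>odd_above\<close>.\<close>
  have odd: "odd_above d (x \<circ> i)" if "i \<in> increasing_tuples (d + 1) S" "\<not> even_above d (x \<circ> i)" for i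
  proof -
    have i: "i \<in> increasing_tuples (d + 1) {..<N}"
      using that(1) S by (auto simp: increasing_tuples_def nsets_def)
    then have cyc: "cyclic_tuple d (x \<circ> i)"
      using assms(1) x(3) by (intro cyclic_projections_imp_cyclic_tuple) auto
    obtain e where e: "affine_dependence d (x \<circ> i) e" "alternating_signs d e"
      using cyclic_tuple_dependence[OF cyc] .
    show ?thesis
      using color_iff_height_sum[OF assms(1) cyc e] that(2)
        general_position_height_sum[OF assms(1) x i e] by linarith
  qed
  have "AB_homogeneous d x S"
    unfolding AB_homogeneous_def using even odd by (cases c) auto
  with S show "\<exists>S\<in>[{..<N}]\<^bsup>k\<^esup>. AB_homogeneous d x S" by blast
qed

section \<open>Finiteness and comparison of the least values\<close>

text \<open>Ramsey's theorem for two colors. The existence it gives is what makes the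
  \<open>LEAST\<close> values meaningful.\<close>

lemma ex_R_mon_property: "\<exists>N. R_mon_property k r N"
proof -
  obtain N :: nat where N: "partn_lst {..<N} [k, k] r" using ramsey_full by blast
  have "\<exists>S \<in> [{..<N}]\<^bsup>k\<^esup>. \<exists>c. \<forall>T \<in> [S]\<^bsup>r\<^esup>. \<chi> T = c" for \<chi> :: "nat set \<Rightarrow> bool"
  proof -
    define f where "f T = (if \<chi> T then 0 else 1::nat)" for T
    have "f \<in> [{..<N}]\<^bsup>r\<^esup> \<rightarrow> {..<length [k, k]}" by (simp add: f_def)
    then obtain b where b: "b < length [k, k]" "monochromatic {..<N} ([k, k] ! b) r f b"
      using N unfolding partn_lst_def by blast
    moreover have "[k, k] ! b = k" using b(1) by (auto simp: less_Suc_eq)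
    ultimately obtain S where S: "S \<in> [{..<N}]\<^bsup>k\<^esup>" "f ` [S]\<^bsup>r\<^esup> \<subseteq> {b}"
      unfolding monochromatic_def by auto
    then have "\<forall>T \<in> [S]\<^bsup>r\<^esup>. \<chi> T = (b = 0)" by (auto simp: f_def split: if_splits)
    with S(1) show ?thesis by blast
  qed
  then show ?thesis unfolding R_mon_property_def by blast
qed

theorem theorem1p2:
  fixes d k :: nat
  assumes "d \<ge> 2" and "k \<ge> d + 1"
  shows "(\<exists>N. EM_property d k N) \<and> (\<exists>N. AB_mc_property d k N) \<and>
         (\<exists>N. AB_property d k N) \<and> (\<exists>N. R_mon_property k (d + 1) N) \<and>
         EM d k = AB_mc d k \<and> AB_mc d k \<le> AB d k \<and> AB d k \<le> R_mon k (d + 1)"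
proof -
  have d: "d \<ge> 1" using assms(1) by simp
  note EM_iff = EM_property_iff_AB_mc_property[OF d]
    and AB_mc = AB_property_imp_AB_mc_property[OF d]
    and AB = R_mon_property_imp_AB_property[OF d]
  have ex_R: "\<exists>N. R_mon_property k (d + 1) N" by (rule ex_R_mon_property)
  then have ex_AB: "\<exists>N. AB_property d k N" using AB by blast
  then have ex_mc: "\<exists>N. AB_mc_property d k N" using AB_mc by blast
  have "EM d k = AB_mc d k" by (simp add: EM_def AB_mc_def EM_iff)
  moreover have "AB_mc d k \<le> AB d k"
    \<comment> \<open>By existence the least value for the stronger property satisfies it, hence
      also the weaker one, whose least value is therefore no larger.\<close>
    unfolding AB_mc_def AB_def by (rule Least_le, rule AB_mc, rule LeastI_ex, rule ex_AB)
  moreover have "AB d k \<le> R_mon k (d + 1)"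
    unfolding AB_def R_mon_def by (rule Least_le, rule AB, rule LeastI_ex, rule ex_R)
  ultimately show ?thesis using ex_R ex_AB ex_mc EM_iff by blast
qed

end
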